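(* Let $A$ be a normed unital algebra (over $\mathbb R$ or $\mathbb C$, with $\|1_A\|=1$) and let $(\Omega,d,\|\cdot\|_\Omega)$ be a normed first-order differential calculus over $A$. Define $L$ on $A$ by $L(a)=\|da\|_\Omega$. Then $L$ is strongly Leibniz.
   Context: A first-order differential calculus over a unital algebra $A$ is a pair $(\Omega,d)$ of an $A$-bimodule $\Omega$ (on which $1_A$ acts as the identity on both sides) and a derivation $d:A\to\Omega$, i.e. a linear map with $d(ab)=(da)b+a(db)$ for all $a,b\in A$. It is normed if $\Omega$ carries a norm with $\|a\omega b\|_\Omega\le\|a\|\,\|\omega\|_\Omega\,\|b\|$ for all $a,b\in A$, $\omega\in\Omega$; $d$ is not required to be continuous. A seminorm $L$ on a normed unital algebra $A$ is Leibniz if $L(ab)\le L(a)\|b\|+\|a\|L(b)$ for all $a,b\in A$; it is strongly Leibniz if it is Leibniz, $L(1)=0$, and $L(a^{-1})\le\|a^{-1}\|^2L(a)$ for every $a\in A$ that has an inverse in $A$. *)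

theory Defs
  imports Complex_Main
begin

(* Algebras and bimodules carry an explicit scalar multiplication over a field 'k, so that real
   and complex scalars are treated together.  In the normed setting 'k is of class
   real_normed_field; its instances include real and complex, and its norm is multiplicative. *)

locale unital_algebra = vector_space scale
  for scale :: "'k::field \<Rightarrow> 'a::ring_1 \<Rightarrow> 'a" +
  assumes scale_mult_left: "scale c (a * b) = scale c a * b"
    and scale_mult_right: "scale c (a * b) = a * scale c b"

locale algebra_bimodule =
  A: unital_algebra scaleA + W: vector_space scaleW
  for scaleA :: "'k::field \<Rightarrow> 'a::ring_1 \<Rightarrow> 'a"
    and scaleW :: "'k \<Rightarrow> 'w::ab_group_add \<Rightarrow> 'w" +
  fixes lact :: "'a \<Rightarrow> 'w \<Rightarrow> 'w" and ract :: "'w \<Rightarrow> 'a \<Rightarrow> 'w"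
  assumes lact_add_left: "lact (a + b) w = lact a w + lact b w"
    and lact_add_right: "lact a (v + w) = lact a v + lact a w"
    and lact_scale_left: "lact (scaleA c a) w = scaleW c (lact a w)"
    and lact_scale_right: "lact a (scaleW c w) = scaleW c (lact a w)"
    and lact_mult: "lact (a * b) w = lact a (lact b w)"
    and lact_one: "lact 1 w = w"
    and ract_add_left: "ract (v + w) a = ract v a + ract w a"
    and ract_add_right: "ract w (a + b) = ract w a + ract w b"
    and ract_scale_left: "ract (scaleW c w) a = scaleW c (ract w a)"
    and ract_scale_right: "ract w (scaleA c a) = scaleW c (ract w a)"
    and ract_mult: "ract w (a * b) = ract (ract w a) b"
    and ract_one: "ract w 1 = w"
    and lact_ract: "ract (lact a w) b = lact a (ract w b)"

locale first_order_calculus = algebra_bimodule scaleA scaleW lact ract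
  for scaleA :: "'k::field \<Rightarrow> 'a::ring_1 \<Rightarrow> 'a"
    and scaleW :: "'k \<Rightarrow> 'w::ab_group_add \<Rightarrow> 'w"
    and lact :: "'a \<Rightarrow> 'w \<Rightarrow> 'w" and ract :: "'w \<Rightarrow> 'a \<Rightarrow> 'w" +
  fixes d :: "'a \<Rightarrow> 'w"
  assumes d_linear: "Vector_Spaces.linear scaleA scaleW d"
    and d_mult: "d (a * b) = ract (d a) b + lact a (d b)"

(* The type class already provides a real norm; what remains is homogeneity over 'k and
   agreement of the real structure of the class with the restriction of the 'k-structure. *)
locale normed_space_over = vector_space scale
  for scale :: "'k::real_normed_field \<Rightarrow> 'v::real_normed_vector \<Rightarrow> 'v" +
  assumes scale_of_real: "scale (of_real r) x = r *\<^sub>R x"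
    and norm_scale: "norm (scale c x) = norm c * norm x"

(* Class real_normed_algebra_1 supplies norm (a * b) \<le> norm a * norm b and norm 1 = 1. *)
locale normed_unital_algebra = unital_algebra scale + normed_space_over scale
  for scale :: "'k::real_normed_field \<Rightarrow> 'a::real_normed_algebra_1 \<Rightarrow> 'a"

locale normed_first_order_calculus =
  first_order_calculus scaleA scaleW lact ract d + W: normed_space_over scaleW
  for scaleA :: "'k::real_normed_field \<Rightarrow> 'a::real_normed_algebra_1 \<Rightarrow> 'a"
    and scaleW :: "'k \<Rightarrow> 'w::real_normed_vector \<Rightarrow> 'w"
    and lact :: "'a \<Rightarrow> 'w \<Rightarrow> 'w" and ract :: "'w \<Rightarrow> 'a \<Rightarrow> 'w" and d :: "'a \<Rightarrow> 'w" +
  assumes norm_act_le: "norm (ract (lact a w) b) \<le> norm a * norm w * norm b"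

definition seminorm_over ::
    "('k::real_normed_field \<Rightarrow> 'v::ab_group_add \<Rightarrow> 'v) \<Rightarrow> ('v \<Rightarrow> real) \<Rightarrow> bool" where
  "seminorm_over scale p \<longleftrightarrow>
     (\<forall>x. 0 \<le> p x) \<and>
     (\<forall>x y. p (x + y) \<le> p x + p y) \<and>
     (\<forall>c x. p (scale c x) = norm c * p x)"

definition leibniz_seminorm ::
    "('k::real_normed_field \<Rightarrow> 'a::real_normed_algebra_1 \<Rightarrow> 'a) \<Rightarrow> ('a \<Rightarrow> real) \<Rightarrow> bool" where
  "leibniz_seminorm scale L \<longleftrightarrow>
     seminorm_over scale L \<and>
     (\<forall>a b. L (a * b) \<le> L a * norm b + norm a * L b)"

(* The algebra has no inverse operation; b is the two-sided inverse of a. *)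
definition strongly_leibniz_seminorm ::
    "('k::real_normed_field \<Rightarrow> 'a::real_normed_algebra_1 \<Rightarrow> 'a) \<Rightarrow> ('a \<Rightarrow> real) \<Rightarrow> bool" where
  "strongly_leibniz_seminorm scale L \<longleftrightarrow>
     leibniz_seminorm scale L \<and>
     L 1 = 0 \<and>
     (\<forall>a b. a * b = 1 \<and> b * a = 1 \<longrightarrow> L b \<le> (norm b)\<^sup>2 * L a)"

end

theory Submission
  imports Defs
begin

text \<open>
  The seminorm axioms and the Leibniz inequality come directly from linearity of \<open>d\<close>, the product
  rule, and the norm estimate with one of the two acting elements equal to \<open>1\<close>, where \<open>\<parallel>1\<parallel> = 1\<close> is
  used. The strong Leibniz inequality is the noncommutative quotient rule: if \<open>b\<close> is inverse to
  \<open>a\<close>, then differentiating \<open>b a = 1\<close> and acting with \<open>b\<close> on the right gives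
  \<open>d b = - b (d a) b\<close>. The norm estimate for the bimodule then yields two factors \<open>\<parallel>b\<parallel>\<close>.
\<close>

text \<open>The product rule applied to \<open>1 = 1 \<cdot> 1\<close> gives \<open>d 1 = d 1 + d 1\<close>.\<close>

lemma (in first_order_calculus) d_one: "d 1 = 0"
  using d_mult[of 1 1] by (simp add: lact_one ract_one)

lemma (in first_order_calculus) d_inverse:
  assumes "a * b = 1" and "b * a = 1"
  shows "d b = - ract (lact b (d a)) b"
proof -
  have "ract (d b) a + lact b (d a) = 0"
    using d_mult[of b a] assms(2) by (simp add: d_one)
  then have "ract (ract (d b) a + lact b (d a)) b = ract (0 + 0) b"
    by simp
  moreover have "ract (0 + 0) b = 0"
    using ract_add_left[of 0 0 b] by simp
  ultimately have "ract (ract (d b) a) b + ract (lact b (d a)) b = 0"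
    by (simp add: ract_add_left)
  moreover have "ract (ract (d b) a) b = d b"
    using assms(1) by (simp add: ract_mult[symmetric] ract_one)
  ultimately show ?thesis
    by (simp add: eq_neg_iff_add_eq_0)
qed

context normed_first_order_calculus
begin

lemma norm_lact_le: "norm (lact a w) \<le> norm a * norm w"
  using norm_act_le[of a w 1] by (simp add: ract_one)

lemma norm_ract_le: "norm (ract w b) \<le> norm w * norm b"
  using norm_act_le[of 1 w b] by (simp add: lact_one)

lemma seminorm_norm_d: "seminorm_over scaleA (\<lambda>a. norm (d a))"
proof -
  have "d (a + b) = d a + d b" and "d (scaleA c a) = scaleW c (d a)" for a b c
    using d_linear by (simp_all add: Vector_Spaces.linear_iff)
  then show ?thesis
    by (simp add: seminorm_over_def W.norm_scale norm_triangle_ineq)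
qed

lemma leibniz_norm_d: "leibniz_seminorm scaleA (\<lambda>a. norm (d a))"
proof -
  have "norm (d (a * b)) \<le> norm (d a) * norm b + norm a * norm (d b)" for a b
    unfolding d_mult by (intro norm_triangle_le add_mono norm_ract_le norm_lact_le)
  then show ?thesis
    by (simp add: leibniz_seminorm_def seminorm_norm_d)
qed

lemma strongly_leibniz_norm_d: "strongly_leibniz_seminorm scaleA (\<lambda>a. norm (d a))"
proof -
  have "norm (d b) \<le> (norm b)\<^sup>2 * norm (d a)" if "a * b = 1" "b * a = 1" for a b
    using norm_act_le[of b "d a" b] d_inverse[OF that]
    by (simp add: power2_eq_square mult_ac)
  then show ?thesis
    by (simp add: strongly_leibniz_seminorm_def leibniz_norm_d d_one)
qed

end

theorem proposition2p1:
  fixes scaleA :: "'k::real_normed_field \<Rightarrow> 'a::real_normed_algebra_1 \<Rightarrow> 'a"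
    and scaleW :: "'k \<Rightarrow> 'w::real_normed_vector \<Rightarrow> 'w"
    and lact :: "'a \<Rightarrow> 'w \<Rightarrow> 'w"
    and ract :: "'w \<Rightarrow> 'a \<Rightarrow> 'w"
    and d :: "'a \<Rightarrow> 'w"
    and L :: "'a \<Rightarrow> real"
  assumes "normed_unital_algebra scaleA"
    and "normed_first_order_calculus scaleA scaleW lact ract d"
    and "\<And>a. L a = norm (d a)"
  shows "strongly_leibniz_seminorm scaleA L"
proof -
  have "L = (\<lambda>a. norm (d a))"
    using assms(3) by (rule ext)
  then show ?thesis
    using normed_first_order_calculus.strongly_leibniz_norm_d[OF assms(2)] by simp
qed

end
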